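(* Let $\bar f\in\mathbb F_q[x_1^{\pm1},\dots,x_n^{\pm1}]$ and $\mu\in\mathbb Z^n$ satisfy: (i) $\dim\Delta_\infty(\bar f)=n$; (ii) $\bar f$ is quasihomogeneous; (iii) $\bar f$ is nondegenerate with respect to $\Delta_\infty(\bar f)$; (iv) $l_\sigma(\mu)<1$; (v) $p\nmid\prod_{\tau\in\Gamma_1}\phi^{(\tau)}(\mu)$. Let $\bar\lambda\in\overline{\mathbb F}_q^*$. Then $\bar F(\bar\lambda,x)=\bar f(x)+\bar\lambda x^\mu$ is nondegenerate with respect to $\Delta_\infty(\bar F(\bar\lambda,x))=\Delta_\infty(\bar f,\mu)$.
   Context: $q$ is a power of the prime $p$. For a Laurent polynomial $\bar g=\sum\bar A(v)x^v$ over $\mathbb F_q$, $Supp(\bar g)=\{v:\bar A(v)\ne0\}$, $\Delta_\infty(\bar g)$ is the convex hull of $Supp(\bar g)\cup\{0\}$, and a face "at $\infty$" is a closed face not containing $0$. For a face $\tau$, $\bar g^{(\tau)}=\sum_{v\in Supp(\bar g)\cap\tau}\bar A(v)x^v$; $\bar g$ is nondegenerate with respect to a polytope $\Delta$ (containing $Supp(\bar g)$ and $0$) if for every face $\tau$ of $\Delta$ at $\infty$ the Laurent polynomials $x_i\partial\bar g^{(\tau)}/\partial x_i$ ($1\le i\le n$) have no common zero in $(\overline{\mathbb F}_q^* )^n$. Quasihomogeneous: $Supp(\bar f)$ lies on an affine hyperplane $l_\sigma(x)=1$, $l_\sigma$ a rational linear form, $\sigma=\Delta(\bar f)$ the convex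 hull of $Supp(\bar f)$. $\Gamma$ is the set of codimension-2 faces at $\infty$ of $\Delta_\infty(\bar f)$; for $\tau\in\Gamma$, $\phi^{(\tau)}$ is the integral linear form with relatively prime coefficients vanishing on $\tau\cup\{0\}$, signs chosen so that the cone over $\Delta_\infty(\bar f)$ is $\{\phi^{(\tau)}\ge0\ \forall\tau\in\Gamma\}$. $\Delta_\infty(\bar f,\mu)$ is the convex hull of $\Delta_\infty(\bar f)\cup\{\mu\}$; $\tau\in\Gamma$ is visible from $\mu$ if the convex hull of $\tau\cup\{\mu\}$ is a face of $\Delta_\infty(\bar f,\mu)$; $\Gamma_1$ is the set of visible $\tau$. *)

theory Defs
  imports
    "HOL-Analysis.Analysis"
    "HOL-Algebra.Algebraic_Closure_Type"
    "HOL-Library.Poly_Mapping"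
begin

text \<open>
  A Laurent polynomial in variables indexed by \<open>'n\<close> is a finitely supported function from
  exponent vectors to coefficients. Its support is \<^const>\<open>Poly_Mapping.keys\<close>, and the
  ring structure of \<^type>\<open>poly_mapping\<close> is that of the group algebra of the exponent group.
\<close>

type_synonym ('n, 'a) laurent = "(int ^ 'n) \<Rightarrow>\<^sub>0 'a"

definition rvec :: "int ^ 'n \<Rightarrow> real ^ 'n" where
  "rvec v = (\<chi> i. of_int (v $ i))"

text \<open>Base change from a field to its algebraic closure.\<close>

definition laurent_ac :: "('n::finite, 'k::field) laurent \<Rightarrow> ('n, 'k alg_closure) laurent" where
  "laurent_ac f = Poly_Mapping.map to_ac f"

definition laurent_eval :: "('n::finite, 'a::field) laurent \<Rightarrow> 'a ^ 'n \<Rightarrow> 'a" where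
  "laurent_eval g x = (\<Sum>v\<in>Poly_Mapping.keys g. Poly_Mapping.lookup g v * (\<Prod>i\<in>UNIV. (x $ i) powi (v $ i)))"

definition laurent_var :: "'n::finite \<Rightarrow> ('n, 'a::field) laurent" where
  "laurent_var i = Poly_Mapping.single (axis i 1) 1"

definition laurent_deriv :: "'n::finite \<Rightarrow> ('n, 'a::field) laurent \<Rightarrow> ('n, 'a) laurent" where
  "laurent_deriv i g =
     (\<Sum>v\<in>Poly_Mapping.keys g. Poly_Mapping.single (v - axis i 1) (of_int (v $ i) * Poly_Mapping.lookup g v))"

definition laurent_restrict :: "(real ^ 'n::finite) set \<Rightarrow> ('n, 'a::field) laurent \<Rightarrow> ('n, 'a) laurent" where
  "laurent_restrict \<tau> g = (\<Sum>v\<in>{v \<in> Poly_Mapping.keys g. rvec v \<in> \<tau>}. Poly_Mapping.single v (Poly_Mapping.lookup g v))"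

definition newton_infty :: "('n::finite, 'a::zero) laurent \<Rightarrow> (real ^ 'n) set" where
  "newton_infty g = convex hull (rvec ` Poly_Mapping.keys g \<union> {0})"

definition newton_infty_ext :: "('n::finite, 'a::zero) laurent \<Rightarrow> int ^ 'n \<Rightarrow> (real ^ 'n) set" where
  "newton_infty_ext g \<mu> = convex hull (newton_infty g \<union> {rvec \<mu>})"

text \<open>
  In the library, the empty set is a face of every set, of affine dimension \<open>-1\<close>.
  It is allowed here, and has to be excluded in the definition of nondegeneracy,
  where it would yield the zero polynomial. It matters for the codimension-2 faces in the
  one-variable case: there it is the only such face, and dropping it would make the condition
  on the visible faces vacuous.
\<close>

definition face_at_infty :: "(real ^ 'n::finite) set \<Rightarrow> (real ^ 'n) set \<Rightarrow> bool" where
  "face_at_infty \<tau> \<Delta> \<longleftrightarrow> \<tau> face_of \<Delta> \<and> 0 \<notin> \<tau>"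

definition nondegenerate :: "('n::finite, 'k::field alg_closure) laurent \<Rightarrow> (real ^ 'n) set \<Rightarrow> bool" where
  "nondegenerate g \<Delta> \<longleftrightarrow>
     (\<forall>\<tau>. face_at_infty \<tau> \<Delta> \<and> \<tau> \<noteq> {} \<longrightarrow>
       \<not> (\<exists>x :: 'k alg_closure ^ 'n. (\<forall>i. x $ i \<noteq> 0) \<and>
            (\<forall>i. laurent_eval (laurent_var i * laurent_deriv i (laurent_restrict \<tau> g)) x = 0)))"

text \<open>
  Quasihomogeneity with \<open>l\<close> the coefficient vector of the rational linear form; the form
  is unique when \<^term>\<open>newton_infty f\<close> has full dimension.
\<close>

definition quasihomogeneous_wrt :: "real ^ 'n::finite \<Rightarrow> ('n, 'a::zero) laurent \<Rightarrow> bool" where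
  "quasihomogeneous_wrt l f \<longleftrightarrow> (\<forall>i. l $ i \<in> \<rat>) \<and> (\<forall>v\<in>Poly_Mapping.keys f. l \<bullet> rvec v = 1)"

definition codim2_faces :: "('n::finite, 'a::zero) laurent \<Rightarrow> (real ^ 'n) set set" where
  "codim2_faces f =
     {\<tau>. face_at_infty \<tau> (newton_infty f) \<and> aff_dim \<tau> = int CARD('n) - 2}"

definition visible_faces :: "('n::finite, 'a::zero) laurent \<Rightarrow> int ^ 'n \<Rightarrow> (real ^ 'n) set set" where
  "visible_faces f \<mu> =
     {\<tau> \<in> codim2_faces f. (convex hull (\<tau> \<union> {rvec \<mu>})) face_of newton_infty_ext f \<mu>}"

text \<open>
  Integral linear forms are given by their coefficient vectors. The last conjunct fixes the signs.
\<close>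

definition face_forms :: "('n::finite, 'a::zero) laurent \<Rightarrow> ((real ^ 'n) set \<Rightarrow> int ^ 'n) \<Rightarrow> bool" where
  "face_forms f \<phi> \<longleftrightarrow>
     (\<forall>\<tau>\<in>codim2_faces f. Gcd (range (($) (\<phi> \<tau>))) = 1 \<and> (\<forall>x\<in>\<tau> \<union> {0}. rvec (\<phi> \<tau>) \<bullet> x = 0)) \<and>
     cone hull newton_infty f = {x. \<forall>\<tau>\<in>codim2_faces f. rvec (\<phi> \<tau>) \<bullet> x \<ge> 0}"

definition int_form :: "int ^ 'n::finite \<Rightarrow> int ^ 'n \<Rightarrow> int" where
  "int_form a v = (\<Sum>i\<in>UNIV. a $ i * v $ i)"

end

theory Submission
  imports Defs "HOL-Number_Theory.Residues"
begin

text \<open>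
  Let \<open>\<Delta>\<close> be the Newton polytope of \<open>F\<close> at infinity. A face of \<open>\<Delta>\<close> at infinity that misses \<open>\<mu>\<close>
  is a face of the Newton polytope of \<open>f\<close>, and \<open>F\<close> restricts to it as \<open>f\<close>. A face \<open>\<tau>\<close> of \<open>\<Delta>\<close> at
  infinity that contains \<open>\<mu>\<close> lies in a facet of \<open>\<Delta>\<close> at infinity; cutting that facet with the
  hyperplane \<open>l = 1\<close> gives a visible codimension-2 face \<open>H\<close>, whose form \<open>\<phi>\<close> vanishes on all the
  exponents of \<open>f\<close> in \<open>\<tau>\<close>. Combining the logarithmic derivatives of \<open>F\<close> restricted to \<open>\<tau>\<close> with the
  coefficients of \<open>\<phi>\<close> leaves the single monomial \<open>\<phi>(\<mu>) lam x\<^sup>\<mu>\<close>, which has no zero on the torus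
  because \<open>p\<close> does not divide \<open>\<phi>(\<mu>)\<close>.
\<close>

lemma face_of_convex_hull_obtain:
  fixes S :: "'a::euclidean_space set"
  assumes "finite S" "T face_of convex hull S"
  obtains S' where "S' \<subseteq> S" "S' \<subseteq> T" "T = convex hull S'"
  by (metis assms face_of_convex_hull_subset finite_imp_compact hull_subset)

text \<open>A face of a polytope is the hull of the generators it contains, so one that misses
  \<open>m\<close> is generated by points of \<open>S\<close>.\<close>

lemma face_of_hull_insert_avoiding:
  fixes S :: "'a::euclidean_space set"
  assumes "finite S" "T face_of convex hull (insert m S)" "m \<notin> T"
  shows "T face_of convex hull S"
proof -
  obtain S' where "S' \<subseteq> insert m S" "S' \<subseteq> T" "T = convex hull S'"
    using face_of_convex_hull_obtain assms by (metis finite_insert)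
  then have "T \<subseteq> convex hull S"
    using assms(3) by (metis hull_mono subset_insert subsetD)
  then show ?thesis
    using assms(2) by (meson face_of_subset hull_mono subset_insertI)
qed

text \<open>All generators except \<open>0\<close> and \<open>m\<close> lie on \<open>l = 1\<close>,
  so a facet through \<open>m\<close> but not through \<open>0\<close> is a pyramid with apex
  \<open>m\<close> over its slice by that hyperplane. The slice serves as \<open>H\<close>, and the
  pyramid witnesses visibility.\<close>

lemma visible_codim2_face:
  fixes S :: "'a::euclidean_space set"
  assumes S: "finite S" "\<And>s. s \<in> S \<Longrightarrow> l \<bullet> s = 1"
    and m: "l \<bullet> m < 1"
    and dim: "aff_dim (convex hull (insert 0 S)) = DIM('a)"
    and T: "T face_of convex hull (insert m (insert 0 S))" "0 \<notin> T" "m \<in> T"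
  obtains H where "H face_of convex hull (insert 0 S)" "0 \<notin> H" "aff_dim H = int DIM('a) - 2"
    "convex hull (insert m H) face_of convex hull (insert m (insert 0 S))" "T \<inter> S \<subseteq> H"
proof -
  let ?V = "insert m (insert 0 S)"
  let ?L = "{x. l \<bullet> x = 1}"
  have poly: "polyhedron (convex hull ?V)"
    by (simp add: S polyhedron_convex_hull)
  have dimQ: "aff_dim (convex hull ?V) = DIM('a)"
    using dim aff_dim_subset[of "convex hull (insert 0 S)" "convex hull ?V"]
      aff_dim_le_DIM[of "convex hull ?V"] by (simp add: hull_mono subset_insertI)
  have "0 \<in> convex hull ?V"
    by (simp add: hull_inc)
  \<comment> \<open>\<open>T\<close> is nonempty by \<open>m\<close> and proper by \<open>0\<close>,
    hence an intersection of facets; one of them must omit \<open>0\<close>.\<close>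
  then have "T = \<Inter>{G. G facet_of convex hull ?V \<and> T \<subseteq> G}"
    using face_of_polyhedron[OF poly T(1)] T by blast
  then obtain G where G: "G facet_of convex hull ?V" "T \<subseteq> G" "0 \<notin> G"
    using T(2) by blast
  have Gface: "G face_of convex hull ?V" and dimG: "aff_dim G = int DIM('a) - 1"
    using G(1) dimQ by (auto simp: facet_of_def)
  have "convex hull ?V \<subseteq> {x. l \<bullet> x \<le> 1}"
    using S(2) m by (intro hull_minimal convex_halfspace_le) auto
  then have "(convex hull ?V \<inter> ?L) face_of convex hull ?V"
    by (intro face_of_Int_supporting_hyperplane_le) auto
  then have "G \<inter> (convex hull ?V \<inter> ?L) face_of convex hull ?V"
    by (rule face_of_Int[OF Gface])
  moreover have "G \<inter> (convex hull ?V \<inter> ?L) = G \<inter> ?L"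
    using face_of_imp_subset[OF Gface] by blast
  ultimately have Hface: "(G \<inter> ?L) face_of convex hull ?V"
    by simp
  have fin: "finite (insert 0 S)"
    using S(1) by simp
  have HP: "(G \<inter> ?L) face_of convex hull (insert 0 S)"
    using face_of_hull_insert_avoiding[OF fin Hface] m by simp
  have mG: "m \<in> G"
    using G T by blast
  obtain S' where S': "S' \<subseteq> ?V" "S' \<subseteq> G" "G = convex hull S'"
    using face_of_convex_hull_obtain[OF _ Gface] S(1) by blast
  \<comment> \<open>The generator \<open>0\<close> is excluded because it is not in
    \<open>G\<close>.\<close>
  have "S' \<subseteq> insert m (G \<inter> ?L)"
    using S' G(3) S(2) by auto
  then have "G \<subseteq> convex hull (insert m (G \<inter> ?L))"
    using S'(3) by (simp add: hull_mono)
  moreover have "convex hull (insert m (G \<inter> ?L)) \<subseteq> G"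
    using mG face_of_imp_convex[OF Gface] by (intro hull_minimal) auto
  ultimately have Geq: "convex hull (insert m (G \<inter> ?L)) = G"
    by blast
  \<comment> \<open>The apex lies off the hyperplane, so it adds exactly one dimension. In dimension
    one the slice is empty, of affine dimension -1, and the count still holds.\<close>
  have "affine hull (G \<inter> ?L) \<subseteq> ?L"
    by (intro hull_minimal affine_hyperplane) auto
  then have "m \<notin> affine hull (G \<inter> ?L)"
    using m by auto
  then have "aff_dim G = aff_dim (G \<inter> ?L) + 1"
    using Geq aff_dim_insert[of m "G \<inter> ?L"] aff_dim_convex_hull[of "insert m (G \<inter> ?L)"] by simp
  then have "aff_dim (G \<inter> ?L) = int DIM('a) - 2"
    using dimG by simp
  moreover have "T \<inter> S \<subseteq> G \<inter> ?L"
    using G(2) S(2) by auto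
  ultimately show thesis
    using that[OF HP] G(3) Gface Geq by simp
qed

lemma laurent_eval_superset:
  assumes "finite K" "Poly_Mapping.keys g \<subseteq> K"
  shows "laurent_eval g x =
    (\<Sum>v\<in>K. Poly_Mapping.lookup g v * (\<Prod>i\<in>UNIV. (x $ i) powi (v $ i)))"
  unfolding laurent_eval_def
  by (rule sum.mono_neutral_left) (use assms in \<open>auto simp: in_keys_iff\<close>)

lemma lookup_log_deriv:
  "Poly_Mapping.lookup (laurent_var i * laurent_deriv i g) v =
    of_int (v $ i) * Poly_Mapping.lookup g v"
proof -
  have "laurent_var i * laurent_deriv i g =
    (\<Sum>v\<in>Poly_Mapping.keys g. Poly_Mapping.single v (of_int (v $ i) * Poly_Mapping.lookup g v))"
    by (simp add: laurent_var_def laurent_deriv_def sum_distrib_left mult_single)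
  then show ?thesis
    by (simp add: lookup_sum lookup_single when_def in_keys_iff)
qed

lemma laurent_eval_log_deriv:
  "laurent_eval (laurent_var i * laurent_deriv i g) x =
    (\<Sum>v\<in>Poly_Mapping.keys g. of_int (v $ i) *
      (Poly_Mapping.lookup g v * (\<Prod>j\<in>UNIV. (x $ j) powi (v $ j))))"
  \<comment> \<open>The derivative may have smaller support, since exponents can vanish modulo the
    characteristic; the extra terms are zero.\<close>
  by (subst laurent_eval_superset[where K = "Poly_Mapping.keys g"])
    (auto simp: lookup_log_deriv in_keys_iff mult.assoc)

text \<open>Each monomial is an eigenvector of every logarithmic derivative, with its exponents as
  eigenvalues, so combining the derivatives with weights \<open>a\<close> scales it by the form's
  value.\<close>

lemma sum_int_form_log_deriv:
  fixes a :: "int ^ 'n::finite"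
  shows "(\<Sum>i\<in>UNIV. of_int (a $ i) * laurent_eval (laurent_var i * laurent_deriv i g) x) =
    (\<Sum>v\<in>Poly_Mapping.keys g. of_int (int_form a v) *
      (Poly_Mapping.lookup g v * (\<Prod>j\<in>UNIV. (x $ j) powi (v $ j))))"
  unfolding laurent_eval_log_deriv sum_distrib_left
  by (subst sum.swap) (simp add: int_form_def sum_distrib_right mult.assoc)

lemma lookup_laurent_restrict:
  "Poly_Mapping.lookup (laurent_restrict T g) v =
    (if rvec v \<in> T then Poly_Mapping.lookup g v else 0)"
  by (simp add: laurent_restrict_def lookup_sum lookup_single when_def in_keys_iff)

lemma lookup_laurent_ac: "Poly_Mapping.lookup (laurent_ac f) v = to_ac (Poly_Mapping.lookup f v)"
  by (simp add: laurent_ac_def Poly_Mapping.map.rep_eq when_def)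

lemma keys_laurent_ac: "Poly_Mapping.keys (laurent_ac f) = Poly_Mapping.keys f"
  by (auto simp: in_keys_iff lookup_laurent_ac)

lemma inner_rvec: "rvec a \<bullet> rvec v = of_int (int_form a v)"
  by (simp add: rvec_def int_form_def inner_vec_def)

text \<open>The characteristic is a prime dividing the cardinality, hence equals \<open>p\<close>,
  and passes to the algebraic closure.\<close>

lemma of_int_eq_0_imp_dvd:
  fixes p r :: nat
  assumes "Factorial_Ring.prime p" "CARD('k::finite_field) = p ^ r"
    and "(of_int k :: 'k alg_closure) = 0"
  shows "int p dvd k"
proof -
  have "Factorial_Ring.prime CHAR('k)" "CHAR('k) dvd p ^ r"
    using CHAR_dvd_CARD[where 'a = 'k] assms(2) by auto
  then have "CHAR('k) = p"
    using assms(1) by (metis prime_dvd_power primes_dvd_imp_eq)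
  then show ?thesis
    using assms(3) by (simp add: of_int_eq_0_iff_char_dvd)
qed

theorem theorem2p1:
  fixes p r :: nat
    and f :: "('n::finite, 'k::finite_field) laurent"
    and \<mu> :: "int ^ 'n"
    and l :: "real ^ 'n"
    and \<phi> :: "(real ^ 'n) set \<Rightarrow> int ^ 'n"
    and lam :: "'k alg_closure"
  assumes "Factorial_Ring.prime p" and "CARD('k) = p ^ r"
    and "aff_dim (newton_infty f) = int CARD('n)"
    and "quasihomogeneous_wrt l f"
    and "nondegenerate (laurent_ac f) (newton_infty f)"
    and "l \<bullet> rvec \<mu> < 1"
    and "face_forms f \<phi>"
    and "\<not> int p dvd (\<Prod>\<tau>\<in>visible_faces f \<mu>. int_form (\<phi> \<tau>) \<mu>)"
    and "lam \<noteq> 0"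
  defines "F \<equiv> laurent_ac f + Poly_Mapping.single \<mu> lam"
  shows "newton_infty F = newton_infty_ext f \<mu> \<and> nondegenerate F (newton_infty F)"
proof -
  define S where "S = rvec ` Poly_Mapping.keys f"
  let ?m = "rvec \<mu>"
  let ?Q = "convex hull (insert ?m (insert 0 S))"
  have S: "finite S" "\<And>s. s \<in> S \<Longrightarrow> l \<bullet> s = 1"
    using assms(4) by (auto simp: S_def quasihomogeneous_wrt_def)
  \<comment> \<open>The form \<open>l\<close> separates \<open>\<mu>\<close> from the support, so
    the new term cannot cancel.\<close>
  have "\<mu> \<notin> Poly_Mapping.keys f"
    using assms(4,6) by (auto simp: quasihomogeneous_wrt_def)
  then have f\<mu>: "Poly_Mapping.lookup f \<mu> = 0"
    by (simp add: in_keys_iff)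
  have lookupF: "Poly_Mapping.lookup F v =
      (if v = \<mu> then lam else to_ac (Poly_Mapping.lookup f v))" for v
    using f\<mu> by (auto simp: F_def lookup_add lookup_laurent_ac lookup_single when_def)
  have keysF: "Poly_Mapping.keys F = insert \<mu> (Poly_Mapping.keys f)"
    using assms(9) by (auto simp: in_keys_iff lookupF split: if_splits)
  have P: "newton_infty f = convex hull (insert 0 S)"
    by (simp add: newton_infty_def S_def)
  have Q: "newton_infty_ext f \<mu> = ?Q"
    unfolding newton_infty_ext_def P
    by (metis Un_commute hull_Un_right insert_is_Un)
  have NF: "newton_infty F = ?Q"
    by (simp add: newton_infty_def keysF S_def insert_commute)
  \<comment> \<open>A product over an infinite set would be 1 by convention; finiteness makes each
    factor divide the product.\<close>
  have "finite {T. T face_of convex hull (insert 0 S)}"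
    using S(1) by (intro finite_polytope_faces polytope_convex_hull) simp
  then have fin: "finite (visible_faces f \<mu>)"
    by (rule rev_finite_subset) (auto simp: visible_faces_def codim2_faces_def face_at_infty_def P)
  have nondeg: False
    if T: "T face_of ?Q" "0 \<notin> T" "T \<noteq> {}" and x: "\<And>i. x $ i \<noteq> 0"
      and zero: "\<And>i. laurent_eval (laurent_var i * laurent_deriv i (laurent_restrict T F)) x = 0"
    for T and x :: "'k alg_closure ^ 'n"
  proof (cases "?m \<in> T")
    case False
    then have "T face_of newton_infty f"
      using face_of_hull_insert_avoiding[OF _ T(1)] S(1) by (simp add: P)
    moreover have "laurent_restrict T F = laurent_restrict T (laurent_ac f)"
      using False
      by (intro poly_mapping_eqI) (auto simp: lookup_laurent_restrict lookupF lookup_laurent_ac)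
    ultimately show False
      using assms(5) T x zero by (auto simp: nondegenerate_def face_at_infty_def)
  next
    case True
    obtain H where H: "H face_of convex hull (insert 0 S)" "0 \<notin> H"
        "aff_dim H = int DIM(real ^ 'n) - 2" "convex hull (insert ?m H) face_of ?Q" "T \<inter> S \<subseteq> H"
      by (rule visible_codim2_face[OF S assms(6) _ T(1,2) True]) (use assms(3) P in auto)
    then have codim: "H \<in> codim2_faces f"
      by (simp add: codim2_faces_def face_at_infty_def P)
    then have "H \<in> visible_faces f \<mu>"
      using H(4) by (simp add: visible_faces_def Q)
    then have "\<not> int p dvd int_form (\<phi> H) \<mu>"
      using assms(8) fin by (meson dvd_prodI dvd_trans)
    then have nz: "(of_int (int_form (\<phi> H) \<mu>) :: 'k alg_closure) \<noteq> 0"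
      using of_int_eq_0_imp_dvd[OF assms(1,2)] by blast
    let ?c = "\<lambda>v. Poly_Mapping.lookup (laurent_restrict T F) v * (\<Prod>j\<in>UNIV. (x $ j) powi (v $ j))"
    have keys: "Poly_Mapping.keys (laurent_restrict T F) = {v \<in> Poly_Mapping.keys F. rvec v \<in> T}"
      by (auto simp: in_keys_iff lookup_laurent_restrict split: if_splits)
    \<comment> \<open>Every exponent other than \<open>\<mu>\<close> comes from \<open>f\<close>, so
      it lies in \<open>T \<inter> S\<close> and hence in \<open>H\<close>.\<close>
    have vanish: "int_form (\<phi> H) v = 0"
      if "v \<in> Poly_Mapping.keys (laurent_restrict T F) - {\<mu>}" for v
    proof -
      have "rvec v \<in> H"
        using that H(5) by (auto simp: keys keysF S_def)
      then have "rvec (\<phi> H) \<bullet> rvec v = 0"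
        using assms(7) codim by (auto simp: face_forms_def)
      then show ?thesis
        by (simp add: inner_rvec)
    qed
    have "0 = (\<Sum>v\<in>Poly_Mapping.keys (laurent_restrict T F). of_int (int_form (\<phi> H) v) * ?c v)"
      using sum_int_form_log_deriv[of "\<phi> H" "laurent_restrict T F" x] zero by simp
    also have "\<dots> = (\<Sum>v\<in>{\<mu>}. of_int (int_form (\<phi> H) v) * ?c v)"
      by (rule sum.mono_neutral_right) (use True vanish in \<open>auto simp: keys keysF\<close>)
    also have "\<dots> = of_int (int_form (\<phi> H) \<mu>) * (lam * (\<Prod>j\<in>UNIV. (x $ j) powi (\<mu> $ j)))"
      using True by (simp add: lookup_laurent_restrict lookupF)
    finally show False
      using nz assms(9) x by simp
  qed
  then have "nondegenerate F ?Q"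
    unfolding nondegenerate_def face_at_infty_def by blast
  then show ?thesis
    by (simp add: NF Q)
qed

end
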